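(* For all $n\ge 1$, the pairs of statistics $(\mathrm{des},\mathrm{drops})$ and $(\mathrm{exc},\mathrm{dp})$ are equidistributed over $\mathfrak{S}_n$; that is, $$\sum_{w \in \mathfrak{S}_n} q^{\mathrm{drops}(w)} t^{\mathrm{des}(w)} = \sum_{w \in \mathfrak{S}_n} q^{\mathrm{dp}(w)} t^{\mathrm{exc}(w)}$$ as polynomials in $q,t$. In particular, for every $k$, $$|\{ w \in \mathfrak{S}_n : \mathrm{dp}(w) =k \}| = |\{ w \in \mathfrak{S}_n : \mathrm{drops}(w) = k\}|.$$
   Context: $\mathfrak{S}_n$ is the group of permutations of $\{1,\dots,n\}$. For $w\in\mathfrak{S}_n$: $\mathrm{des}(w)=|\{i : 1\le i\le n-1,\ w(i)>w(i+1)\}|$ (descent number); $\mathrm{exc}(w)=|\{i : w(i)>i\}|$ (excedance number); $\mathrm{drops}(w)=\sum_{1\le i\le n-1,\ w(i)>w(i+1)}(w(i)-w(i+1))$ (descent drop). For $1\le i<j\le n$, $t_{ij}$ denotes the transposition interchanging $i$ and $j$; its depth is $j-i$. The depth of $w$ is $$\mathrm{dp}(w)=\min\Big\{\sum_{r=1}^k (j_r-i_r) : k\ge 0,\ w=t_{i_1j_1}\cdots t_{i_kj_k},\ i_r<j_r\Big\}.$$ *)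

theory Defs
  imports "HOL-Combinatorics.Permutations" "HOL-Computational_Algebra.Polynomial"
begin

text \<open>
  The symmetric group on \<open>{1, ..., n}\<close> is the set of functions \<open>w :: nat \<Rightarrow> nat\<close> with
  \<open>w permutes {1..n}\<close>; such a \<open>w\<close> is the identity outside \<open>{1..n}\<close>.
\<close>

definition des :: "nat \<Rightarrow> (nat \<Rightarrow> nat) \<Rightarrow> nat" where
  "des n w = card {i \<in> {1..<n}. w i > w (i + 1)}"

definition exc :: "nat \<Rightarrow> (nat \<Rightarrow> nat) \<Rightarrow> nat" where
  "exc n w = card {i \<in> {1..n}. w i > i}"

definition drops :: "nat \<Rightarrow> (nat \<Rightarrow> nat) \<Rightarrow> nat" where
  "drops n w = (\<Sum>i \<in> {i \<in> {1..<n}. w i > w (i + 1)}. w i - w (i + 1))"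

text \<open>
  A list \<open>[(i\<^sub>1, j\<^sub>1), ..., (i\<^sub>k, j\<^sub>k)]\<close> encodes the factorization
  of \<open>w\<close> as the product of the transpositions of \<open>i\<^sub>r\<close> and \<open>j\<^sub>r\<close> in this order; the empty list encodes the identity.
\<close>

definition transp_factorization :: "nat \<Rightarrow> (nat \<Rightarrow> nat) \<Rightarrow> (nat \<times> nat) list \<Rightarrow> bool" where
  "transp_factorization n w ts \<longleftrightarrow>
     (\<forall>(i, j) \<in> set ts. 1 \<le> i \<and> i < j \<and> j \<le> n) \<and>
     w = apply_transps ts"

text \<open>
  The infimum is over a set of natural numbers, hence a minimum whenever the set is nonempty;
  lemma \<open>dp_attained\<close> below shows that this is the case for every permutation.
\<close>

definition dp :: "nat \<Rightarrow> (nat \<Rightarrow> nat) \<Rightarrow> nat" where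
  "dp n w = Inf {(\<Sum>(i, j) \<leftarrow> ts. j - i) | ts. transp_factorization n w ts}"

lemma transp_factorization_exists:
  assumes "w permutes {1..n}"
  shows "\<exists>ts. transp_factorization n w ts"
proof -
  have "finite {1..n}" by simp
  with assms show ?thesis
  proof (induction w rule: permutes_induct)
    case id
    have "transp_factorization n id []" by (simp add: transp_factorization_def)
    then show ?case by blast
  next
    case (swap a b p)
    then obtain ts where ts: "transp_factorization n p ts" by blast
    have "transp_factorization n (Transposition.transpose a b \<circ> p) ((min a b, max a b) # ts)"
      using ts swap.hyps
      by (auto simp: transp_factorization_def min_def max_def transpose_commute)
    then show ?case by blast
  qed
qed

lemma dp_attained:
  assumes "w permutes {1..n}"
  shows "\<exists>ts. transp_factorization n w ts \<and> dp n w = (\<Sum>(i, j) \<leftarrow> ts. j - i)"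
proof -
  let ?S = "{(\<Sum>(i, j) \<leftarrow> ts. j - i) | ts. transp_factorization n w ts}"
  have "?S \<noteq> {}" using transp_factorization_exists[OF assms] by blast
  then have "dp n w \<in> ?S" unfolding dp_def by (rule Inf_nat_def1)
  then show ?thesis by blast
qed

text \<open>
  Polynomials in \<open>q, t\<close> are elements of \<open>\<int>[q][t]\<close>.
\<close>

definition q_var :: "int poly poly" where
  "q_var = [:[:0, 1:]:]"

definition t_var :: "int poly poly" where
  "t_var = [:0, 1:]"

end

theory Submission
  imports Defs
begin

text \<open>
  The depth of \<open>w\<close> equals its total excedance \<open>\<Sum>x. max x (w x) - x\<close>. Multiplying by \<open>t\<^sub>i\<^sub>j\<close> raises the
  total excedance by at most \<open>j - i\<close>, and for \<open>w \<noteq> id\<close> some \<open>t\<^sub>i\<^sub>j\<close> lowers it by exactly \<open>j - i\<close>.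

  Read \<open>w\<close> as a word. Its descents and drops are determined by the function sending a letter \<open>y\<close> to
  the larger of \<open>y\<close> and its left neighbour, exactly as excedances and total excedance are determined
  by \<open>y \<mapsto> max y (w y)\<close>. Inserting the letter \<open>n + 1\<close> into a word, and inserting \<open>n + 1\<close> into
  a cycle of a permutation, have the same effect on these functions: either nothing changes or one
  value at some \<open>y \<le> n\<close> becomes \<open>n + 1\<close>, each \<open>y\<close> occurring once. By induction on \<open>n\<close> the two
  functions are equidistributed.
\<close>

section \<open>Depth is total excedance\<close>

definition total_exc :: "nat \<Rightarrow> (nat \<Rightarrow> nat) \<Rightarrow> nat" where
  "total_exc n w = (\<Sum>x\<in>{1..n}. w x - x)"

text \<open>Only two summands change. Where \<open>p\<close> takes the value \<open>i\<close> the
  new value is \<open>j\<close>, a gain of at most \<open>j - i\<close>; where it takes the value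
  \<open>j\<close> the new value is \<open>i\<close>, which gains nothing.\<close>

lemma total_exc_transpose_le:
  assumes p: "p permutes {1..n}" and ij: "1 \<le> i" "i < j" "j \<le> n"
  shows "total_exc n (Transposition.transpose i j \<circ> p) \<le> (j - i) + total_exc n p"
proof -
  have pi: "p x = i \<longleftrightarrow> x = inv p i" for x
    using permutes_inverses[OF p] by metis
  have "total_exc n (Transposition.transpose i j \<circ> p)
      \<le> (\<Sum>x\<in>{1..n}. (if x = inv p i then j - i else 0) + (p x - x))"
    unfolding total_exc_def
    by (rule sum_mono) (use ij in \<open>auto simp: transpose_def pi[symmetric]\<close>)
  also have "\<dots> \<le> (j - i) + total_exc n p"
    by (simp add: sum.distrib total_exc_def)
  finally show ?thesis .
qed

lemma apply_transps_permutes: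
  assumes "\<forall>(i, j) \<in> set ts. i \<in> S \<and> j \<in> S"
  shows "apply_transps ts permutes S"
  using assms
  by (induction ts) (auto intro!: permutes_compose permutes_swap_id)

lemma total_exc_le_weight:
  assumes "\<forall>(i, j) \<in> set ts. 1 \<le> i \<and> i < j \<and> j \<le> n"
  shows "total_exc n (apply_transps ts) \<le> (\<Sum>(i, j) \<leftarrow> ts. j - i)"
  using assms
proof (induction ts)
  case Nil
  then show ?case by (simp add: total_exc_def)
next
  case (Cons t ts)
  obtain i j where t: "t = (i, j)" by force
  have "apply_transps ts permutes {1..n}"
    using Cons.prems by (intro apply_transps_permutes) force
  then have "total_exc n (Transposition.transpose i j \<circ> apply_transps ts)
      \<le> (j - i) + total_exc n (apply_transps ts)"
    using Cons.prems t by (intro total_exc_transpose_le) auto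
  moreover have "total_exc n (apply_transps ts) \<le> (\<Sum>(i, j) \<leftarrow> ts. j - i)"
    using Cons by simp
  ultimately have "total_exc n (Transposition.transpose i j \<circ> apply_transps ts)
      \<le> (j - i) + (\<Sum>(i, j) \<leftarrow> ts. j - i)"
    by linarith
  then show ?case by (simp add: t comp_def)
qed

text \<open>
  The values \<open>i < j\<close> are chosen with only fixed points strictly between them, \<open>i\<close> lying to the right
  of its place and \<open>j\<close> to the left; hence \<open>w\<inverse> j \<le> i < j \<le> w\<inverse> i\<close>, and exchanging them loses nothing.
\<close>

lemma shallow_transposition_exists:
  assumes p: "p permutes {1..n}" and "p \<noteq> id"
  obtains i j where "1 \<le> i" "i < j" "j \<le> n"
    "total_exc n p = (j - i) + total_exc n (Transposition.transpose i j \<circ> p)"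
proof -
  define r where "r = inv p"
  have r: "r permutes {1..n}" using p by (simp add: r_def permutes_inv)
  have r_inj: "r x = r y \<longleftrightarrow> x = y" for x y
    using permutes_inj[OF r] by (auto dest: injD)
  have pr: "p x = y \<longleftrightarrow> x = r y" for x y
    using permutes_inverses[OF p] unfolding r_def by metis
  have r_in: "r x \<in> {1..n}" if "x \<in> {1..n}" for x
    using permutes_in_image[OF r] that by blast
  have r_out: "r x = x" if "x \<notin> {1..n}" for x
    using permutes_not_in[OF r] that by blast
  have "r \<noteq> id"
    using \<open>p \<noteq> id\<close> pr by fastforce
  define I where "I = {v. r v > v}"
  have I_sub: "I \<subseteq> {1..n}" unfolding I_def using r_out by force
  then have finI: "finite I" by (rule finite_subset) simp
  have "I \<noteq> {}"
    using permutes_natset_le[OF r] \<open>r \<noteq> id\<close> unfolding I_def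
    by (metis (no_types, lifting) Collect_empty_eq not_le)
  define i where "i = Max I"
  have "i \<in> I" unfolding i_def using finI \<open>I \<noteq> {}\<close> by (rule Max_in)
  then have i: "r i > i" "i \<in> {1..n}" using I_sub by (auto simp: I_def)
  \<comment> \<open>By maximality of \<open>i\<close>, every larger value stands at its own place or
    to the left of it.\<close>
  have above: "r v \<le> v" if "v > i" for v
    using that Max_ge[OF finI, of v, folded i_def] by (auto simp: I_def not_le[symmetric])
  define j where "j = (LEAST v. i < v \<and> r v \<noteq> v)"
  \<comment> \<open>\<open>r i\<close> witnesses that the set defining \<open>j\<close> is nonempty:
    if \<open>r\<close> fixed \<open>r i\<close>, injectivity would give
    \<open>r i = i\<close>.\<close>
  have "i < r i \<and> r (r i) \<noteq> r i"
    using i by (simp add: r_inj)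
  then have j: "i < j \<and> r j \<noteq> j"
    unfolding j_def by (rule LeastI)
  have between: "r v = v" if "i < v" "v < j" for v
    using not_less_Least[of v "\<lambda>v. i < v \<and> r v \<noteq> v"] that unfolding j_def by blast
  have jn: "j \<le> n" using j r_out[of j] by force
  have rj: "r j < j" using above[of j] j by simp
  \<comment> \<open>Otherwise \<open>r j\<close> lies strictly between \<open>i\<close> and
    \<open>j\<close> and is fixed by \<open>r\<close>, so injectivity forces \<open>r j = j\<close>.
    The bound on \<open>r i\<close> is analogous.\<close>
  have a: "r j \<le> i"
    using between[of "r j"] rj j r_inj by (metis not_le)
  have b: "j \<le> r i"
    using between[of "r i"] i j r_inj by (metis not_le less_irrefl)
  have rj_in: "r j \<in> {1..n}" using r_in jn j by auto
  \<comment> \<open>At \<open>r j \<le> i\<close> the value drops from \<open>j\<close> to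
    \<open>i\<close>, losing exactly \<open>j - i\<close>. At \<open>r i \<ge> j\<close> the
    truncated difference is 0 both before and after.\<close>
  have "total_exc n p = (\<Sum>x\<in>{1..n}. (if x = r j then j - i else 0)
      + ((Transposition.transpose i j \<circ> p) x - x))"
    unfolding total_exc_def
  proof (rule sum.cong[OF refl])
    fix x
    consider "x = r i" | "x = r j" | "p x \<noteq> i" "p x \<noteq> j"
      using pr by blast
    then show "p x - x = (if x = r j then j - i else 0)
      + ((Transposition.transpose i j \<circ> p) x - x)"
    proof cases
      case 1
      then have "p x = i" using pr by blast
      then show ?thesis using 1 a b j by (auto simp: r_inj)
    next
      case 2
      then have "p x = j" using pr by blast
      then show ?thesis using 2 a j by auto
    next
      case 3
      then show ?thesis using pr by auto
    qed
  qed
  also have "\<dots> = (j - i) + total_exc n (Transposition.transpose i j \<circ> p)"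
    using rj_in by (simp add: sum.distrib total_exc_def del: atLeastAtMost_iff)
  finally show thesis
    using that[of i j] i j jn by auto
qed

lemma total_exc_attained:
  assumes "p permutes {1..n}"
  shows "\<exists>ts. transp_factorization n p ts \<and> (\<Sum>(i, j) \<leftarrow> ts. j - i) = total_exc n p"
  using assms
proof (induction "total_exc n p" arbitrary: p rule: less_induct)
  case less
  show ?case
  proof (cases "p = id")
    case True
    then show ?thesis
      by (intro exI[of _ "[]"]) (auto simp: transp_factorization_def total_exc_def)
  next
    case False
    obtain i j where ij: "1 \<le> i" "i < j" "j \<le> n"
      and eq: "total_exc n p = (j - i) + total_exc n (Transposition.transpose i j \<circ> p)"
      using shallow_transposition_exists[OF less.prems False] by blast
    have "Transposition.transpose i j \<circ> p permutes {1..n}"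
      using ij by (intro permutes_compose[OF less.prems] permutes_swap_id) auto
    moreover have "total_exc n (Transposition.transpose i j \<circ> p) < total_exc n p"
      using eq ij by linarith
    ultimately obtain ts
      where ts: "transp_factorization n (Transposition.transpose i j \<circ> p) ts"
        "(\<Sum>(i, j) \<leftarrow> ts. j - i) = total_exc n (Transposition.transpose i j \<circ> p)"
      using less.hyps by blast
    have "p = Transposition.transpose i j \<circ> (Transposition.transpose i j \<circ> p)"
      by (simp add: fun_eq_iff)
    also have "\<dots> = apply_transps ((i, j) # ts)"
      using ts(1) by (simp add: transp_factorization_def)
    finally have "transp_factorization n p ((i, j) # ts)"
      using ts(1) ij by (auto simp: transp_factorization_def)
    then show ?thesis
      using ts(2) eq by (intro exI[of _ "(i, j) # ts"]) simp
  qed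
qed

lemma dp_eq_total_exc:
  assumes "w permutes {1..n}"
  shows "dp n w = total_exc n w"
proof (rule antisym)
  show "dp n w \<le> total_exc n w"
  proof -
    obtain ts where "transp_factorization n w ts" "(\<Sum>(i, j) \<leftarrow> ts. j - i) = total_exc n w"
      using total_exc_attained[OF assms] by blast
    then show ?thesis
      unfolding dp_def by (intro wellorder_Inf_le1) (auto intro: sym)
  qed
  show "total_exc n w \<le> dp n w"
    using dp_attained[OF assms] total_exc_le_weight
    unfolding transp_factorization_def by force
qed

section \<open>Words and permutations\<close>

definition exc_fun :: "(nat \<Rightarrow> nat) \<Rightarrow> nat \<Rightarrow> nat" where
  "exc_fun w y = max y (w y)"

text \<open>
  Since \<open>w 0 = 0\<close>, the first letter gets a left neighbour \<open>0\<close>, which never exceeds it; and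
  \<open>desc_fun w y = y\<close> for every \<open>y\<close> that is not a letter.
\<close>

definition desc_fun :: "(nat \<Rightarrow> nat) \<Rightarrow> nat \<Rightarrow> nat" where
  "desc_fun w y = max y (w (inv w y - 1))"

text \<open>In one-line notation, the letter \<open>Suc n\<close> is put at position
  \<open>k\<close> and the later letters move one place right.\<close>

definition insert_max :: "nat \<Rightarrow> nat \<Rightarrow> (nat \<Rightarrow> nat) \<Rightarrow> nat \<Rightarrow> nat" where
  "insert_max n k w i =
     (if i < k then w i else if i = k then Suc n else if i \<le> Suc n then w (i - 1) else i)"

lemma desc_fun_apply:
  assumes "w permutes S"
  shows "desc_fun w (w i) = max (w i) (w (i - 1))"
  using permutes_inverses(2)[OF assms] by (simp add: desc_fun_def)

lemma desc_fun_outside: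
  assumes "w permutes {1..n}" "n < y"
  shows "desc_fun w y = y"
proof -
  have "w y = y" using assms by (simp add: permutes_not_in)
  moreover have "w (y - 1) \<le> y"
    using permutes_in_image[OF assms(1), of "y - 1"] permutes_not_in[OF assms(1), of "y - 1"] assms(2)
    by (cases "y - 1 \<in> {1..n}") auto
  ultimately show ?thesis
    using desc_fun_apply[OF assms(1), of y] by simp
qed

lemma insert_max_permutes:
  assumes w: "w permutes {1..n}" and k: "k \<in> {1..Suc n}"
  shows "insert_max n k w permutes {1..Suc n}"
proof (rule bij_imp_permutes)
  have w_in: "w i \<in> {1..n} \<longleftrightarrow> i \<in> {1..n}" for i
    using permutes_in_image[OF w] .
  have w_inj: "w x = w y \<longleftrightarrow> x = y" for x y
    using permutes_inj[OF w] by (auto dest: injD)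
  have low: "w i \<in> {1..n}" if "1 \<le> i" "i < k" for i
    using w_in[of i] that k by auto
  have high: "w (i - 1) \<in> {1..n}" if "k < i" "i \<le> Suc n" for i
    using w_in[of "i - 1"] that k by auto
  have "insert_max n k w i \<in> {1..Suc n}" if "i \<in> {1..Suc n}" for i
    using that low[of i] high[of i] by (auto simp: insert_max_def)
  then have "insert_max n k w ` {1..Suc n} \<subseteq> {1..Suc n}"
    by blast
  moreover have "inj_on (insert_max n k w) {1..Suc n}"
  proof (rule inj_onI)
    fix x y
    assume xy: "x \<in> {1..Suc n}" "y \<in> {1..Suc n}" "insert_max n k w x = insert_max n k w y"
    have eq: "insert_max n k w i = w (if i < k then i else i - 1)"
      and neq: "insert_max n k w i \<noteq> Suc n" if "i \<in> {1..Suc n}" "i \<noteq> k" for i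
      using that low[of i] high[of i] by (auto simp: insert_max_def)
    have k_eq: "insert_max n k w k = Suc n" by (simp add: insert_max_def)
    show "x = y"
    proof (cases "x = k \<or> y = k")
      case True
      then show ?thesis using xy neq k_eq by metis
    next
      case False
      then have "w (if x < k then x else x - 1) = w (if y < k then y else y - 1)"
        using eq[OF xy(1)] eq[OF xy(2)] xy(3) by argo
      then have "(if x < k then x else x - 1) = (if y < k then y else y - 1)"
        by (simp only: w_inj)
      then show ?thesis using False xy by (auto split: if_splits)
    qed
  qed
  ultimately show "bij_betw (insert_max n k w) {1..Suc n} {1..Suc n}"
    unfolding bij_betw_def by (simp add: endo_inj_surj)
  show "insert_max n k w x = x" if "x \<notin> {1..Suc n}" for x
    using that k permutes_not_in[OF w, of x] by (auto simp: insert_max_def)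
qed

lemma insert_max_inj:
  "inj_on (\<lambda>(k, w). insert_max n k w) ({1..Suc n} \<times> {w. w permutes {1..n}})"
proof (intro inj_onI, clarify)
  fix k w k' w'
  assume k: "k \<in> {1..Suc n}" "k' \<in> {1..Suc n}"
    and w: "w permutes {1..n}" "w' permutes {1..n}"
    and eq: "insert_max n k w = insert_max n k' w'"
  have "insert_max n k w k = Suc n" "insert_max n k' w' k' = Suc n"
    by (simp_all add: insert_max_def)
  then have "insert_max n k' w' k = insert_max n k' w' k'"
    by (simp add: eq)
  then have kk: "k = k'"
    using permutes_inj[OF insert_max_permutes[OF w(2) k(2)]] by (auto dest: injD)
  have "w i = w' i" for i
  proof (cases "i \<in> {1..n}")
    case True
    then show ?thesis
      using fun_cong[OF eq, of i] fun_cong[OF eq, of "Suc i"] kk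
      by (cases "i < k") (auto simp: insert_max_def)
  next
    case False
    then show ?thesis using w by (simp add: permutes_not_in)
  qed
  with kk show "k = k' \<and> w = w'" by auto
qed

text \<open>Injectivity suffices, since both sides have \<open>(n + 1)!\<close> elements.\<close>

lemma bij_betw_insert_max:
  "bij_betw (\<lambda>(k, w). insert_max n k w) ({1..Suc n} \<times> {w. w permutes {1..n}})
     {w. w permutes {1..Suc n}}"
  unfolding bij_betw_def
proof (intro conjI card_subset_eq)
  show inj: "inj_on (\<lambda>(k, w). insert_max n k w) ({1..Suc n} \<times> {w. w permutes {1..n}})"
    by (rule insert_max_inj)
  show "finite {w. w permutes {1..Suc n}}"
    by (simp add: finite_permutations)
  show "(\<lambda>(k, w). insert_max n k w) ` ({1..Suc n} \<times> {w. w permutes {1..n}})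
      \<subseteq> {w. w permutes {1..Suc n}}"
    using insert_max_permutes by auto
  show "card ((\<lambda>(k, w). insert_max n k w) ` ({1..Suc n} \<times> {w. w permutes {1..n}}))
      = card {w. w permutes {1..Suc n}}"
    unfolding card_image[OF inj] card_cartesian_product
    by (simp add: card_permutations[OF refl])
qed

text \<open>Among the old letters only \<open>w k\<close>, the one pushed away from position
  \<open>k\<close>, gets a new left neighbour, namely \<open>Suc n\<close>. If
  \<open>k = Suc n\<close>, then \<open>w k = Suc n\<close> and the update is void.\<close>

lemma desc_fun_insert_max:
  assumes w: "w permutes {1..n}" and k: "k \<in> {1..Suc n}"
  shows "desc_fun (insert_max n k w) = (desc_fun w)(w k := Suc n)"
proof
  fix y
  let ?w = "insert_max n k w"
  have perm: "?w permutes {1..Suc n}" by (rule insert_max_permutes[OF w k])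
  have w_in: "w i \<in> {1..n} \<longleftrightarrow> i \<in> {1..n}" for i
    using permutes_in_image[OF w] .
  have w_inj: "w x = w y \<longleftrightarrow> x = y" for x y
    using permutes_inj[OF w] by (auto dest: injD)
  have w_Suc: "w (Suc n) = Suc n" using w by (simp add: permutes_not_in)
  have w_le: "w i \<le> Suc n" if "i \<le> Suc n" for i
    using w_in[of i] permutes_not_in[OF w, of i] that by (cases "i \<in> {1..n}") auto
  obtain i where y: "y = ?w i"
    using permutes_surj[OF perm] by (metis surjD)
  have d: "desc_fun ?w y = max (?w i) (?w (i - 1))"
    unfolding y by (rule desc_fun_apply[OF perm])
  \<comment> \<open>The position of \<open>y\<close> in the new word: before the new letter, at it,
    directly after it, further right, or outside the word.\<close>
  consider "i < k" | "i = k" | "i = Suc k" "i \<le> Suc n" | "Suc k < i" "i \<le> Suc n" | "Suc n < i"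
    using k by fastforce
  then show "desc_fun ?w y = ((desc_fun w)(w k := Suc n)) y"
  proof cases
    case 1
    then have "?w i = w i" "?w (i - 1) = w (i - 1)" by (auto simp: insert_max_def)
    then show ?thesis using d y 1 by (simp add: desc_fun_apply[OF w] w_inj)
  next
    case 2
    then have "y = Suc n" "?w (i - 1) = w (i - 1)" using k y by (auto simp: insert_max_def)
    then show ?thesis
      using d y w_le[of "i - 1"] 2 k desc_fun_outside[OF w, of "Suc n"] by auto
  next
    case 3
    then have "?w i = w k" "?w (i - 1) = Suc n" by (auto simp: insert_max_def)
    then show ?thesis using d y w_le[of k] 3 by simp
  next
    case 4
    then have "?w i = w (i - 1)" "?w (i - 1) = w (i - 1 - 1)" by (auto simp: insert_max_def)
    moreover from 4 have "i - 1 \<noteq> k" by linarith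
    ultimately show ?thesis using d y by (simp add: desc_fun_apply[OF w] w_inj)
  next
    case 5
    then have "y = i" using k y by (auto simp: insert_max_def)
    moreover have "w k \<noteq> i" using 5 k w_le[of k] by simp
    ultimately show ?thesis
      using 5 desc_fun_outside[OF w, of i] desc_fun_outside[OF perm, of i] by simp
  qed
qed

text \<open>The composition inserts \<open>Suc n\<close> into the cycle of \<open>y\<close> directly
  after \<open>y\<close>, so that \<open>y\<close> goes to \<open>Suc n\<close> and
  \<open>Suc n\<close> to \<open>q y\<close>. The latter is no excedance.\<close>

lemma exc_fun_transpose:
  assumes q: "q permutes {1..n}" and y: "y \<in> {1..Suc n}"
  shows "exc_fun (Transposition.transpose (Suc n) (q y) \<circ> q) = (exc_fun q)(y := Suc n)"
proof
  fix x
  have q_in: "q i \<in> {1..n} \<longleftrightarrow> i \<in> {1..n}" for i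
    using permutes_in_image[OF q] .
  have q_inj: "q x = q y \<longleftrightarrow> x = y" for x y
    using permutes_inj[OF q] by (auto dest: injD)
  have q_Suc: "q (Suc n) = Suc n" using q by (simp add: permutes_not_in)
  then have q_Suc_iff: "q x = Suc n \<longleftrightarrow> x = Suc n" for x
    using q_inj by metis
  have q_le: "q i \<le> Suc n" if "i \<le> Suc n" for i
    using q_in[of i] permutes_not_in[OF q, of i] that by (cases "i \<in> {1..n}") auto
  show "exc_fun (Transposition.transpose (Suc n) (q y) \<circ> q) x = ((exc_fun q)(y := Suc n)) x"
  proof (cases "x = y")
    case True
    then show ?thesis using y by (simp add: exc_fun_def)
  next
    case False
    show ?thesis
    proof (cases "x = Suc n")
      case True
      then show ?thesis
        using False q_le[of y] y by (simp add: exc_fun_def q_Suc)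
    next
      case neq: False
      then show ?thesis
        using False by (simp add: exc_fun_def transpose_def q_inj q_Suc_iff)
    qed
  qed
qed

text \<open>
  The summand \<open>y = Suc n\<close> is the unmodified function, as \<open>Suc n\<close> is its own value already; it comes
  from appending the letter \<open>Suc n\<close>, and below from the permutations fixing \<open>Suc n\<close>.
\<close>

lemma sum_desc_fun_Suc:
  fixes F :: "(nat \<Rightarrow> nat) \<Rightarrow> 'a::comm_monoid_add"
  shows "(\<Sum>w | w permutes {1..Suc n}. F (desc_fun w)) =
    (\<Sum>w | w permutes {1..n}. \<Sum>y\<in>{1..Suc n}. F ((desc_fun w)(y := Suc n)))"
proof -
  have "(\<Sum>w | w permutes {1..Suc n}. F (desc_fun w)) =
      (\<Sum>(k, w)\<in>{1..Suc n} \<times> {w. w permutes {1..n}}. F (desc_fun (insert_max n k w)))"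
    using sum.reindex_bij_betw[OF bij_betw_insert_max, of "\<lambda>w. F (desc_fun w)" n]
    by (simp only: case_prod_unfold)
  also have "\<dots> = (\<Sum>(k, w)\<in>{1..Suc n} \<times> {w. w permutes {1..n}}. F ((desc_fun w)(w k := Suc n)))"
    by (intro sum.cong refl) (clarsimp simp: desc_fun_insert_max)
  also have "\<dots> = (\<Sum>w | w permutes {1..n}. \<Sum>k\<in>{1..Suc n}. F ((desc_fun w)(w k := Suc n)))"
    unfolding sum.cartesian_product[symmetric] by (rule sum.swap)
  also have "\<dots> = (\<Sum>w | w permutes {1..n}. \<Sum>y\<in>{1..Suc n}. F ((desc_fun w)(y := Suc n)))"
  proof (rule sum.cong[OF refl])
    fix w assume "w \<in> {w. w permutes {1..n}}"
    \<comment> \<open>Since \<open>w\<close> fixes \<open>Suc n\<close>, the letter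
      \<open>w k\<close> runs through \<open>{1..Suc n}\<close> as \<open>k\<close> does.\<close>
    then have "w permutes {1..Suc n}"
      by (auto elim: permutes_subset)
    then show "(\<Sum>k\<in>{1..Suc n}. F ((desc_fun w)(w k := Suc n))) =
        (\<Sum>y\<in>{1..Suc n}. F ((desc_fun w)(y := Suc n)))"
      using sum.permute[of w _ "\<lambda>y. F ((desc_fun w)(y := Suc n))"] by (simp only: comp_def)
  qed
  finally show ?thesis .
qed

lemma sum_exc_fun_Suc:
  fixes F :: "(nat \<Rightarrow> nat) \<Rightarrow> 'a::comm_monoid_add"
  shows "(\<Sum>w | w permutes {1..Suc n}. F (exc_fun w)) =
    (\<Sum>w | w permutes {1..n}. \<Sum>y\<in>{1..Suc n}. F ((exc_fun w)(y := Suc n)))"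
proof -
  have ins: "{1..Suc n} = insert (Suc n) {1..n}" by auto
  \<comment> \<open>Each permutation of \<open>{1..Suc n}\<close> arises from exactly one pair
    \<open>b\<close>, \<open>q\<close>, where \<open>b\<close> is its value at
    \<open>Suc n\<close>.\<close>
  have "(\<Sum>w | w permutes {1..Suc n}. F (exc_fun w)) =
      (\<Sum>b\<in>{1..Suc n}. \<Sum>q | q permutes {1..n}. F (exc_fun (Transposition.transpose (Suc n) b \<circ> q)))"
    unfolding ins by (rule sum_over_permutations_insert) auto
  also have "\<dots> = (\<Sum>q | q permutes {1..n}. \<Sum>b\<in>{1..Suc n}. F (exc_fun (Transposition.transpose (Suc n) b \<circ> q)))"
    by (rule sum.swap)
  also have "\<dots> = (\<Sum>w | w permutes {1..n}. \<Sum>y\<in>{1..Suc n}. F ((exc_fun w)(y := Suc n)))"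
  proof (rule sum.cong[OF refl])
    fix q assume "q \<in> {w. w permutes {1..n}}"
    then have q: "q permutes {1..n}" by simp
    then have "q permutes {1..Suc n}"
      by (rule permutes_subset) auto
    then have "(\<Sum>b\<in>{1..Suc n}. F (exc_fun (Transposition.transpose (Suc n) b \<circ> q))) =
        (\<Sum>y\<in>{1..Suc n}. F (exc_fun (Transposition.transpose (Suc n) (q y) \<circ> q)))"
      using sum.permute[of q _ "\<lambda>b. F (exc_fun (Transposition.transpose (Suc n) b \<circ> q))"]
      by (simp only: comp_def)
    also have "\<dots> = (\<Sum>y\<in>{1..Suc n}. F ((exc_fun q)(y := Suc n)))"
      by (intro sum.cong refl) (simp add: exc_fun_transpose[OF q])
    finally show "(\<Sum>b\<in>{1..Suc n}. F (exc_fun (Transposition.transpose (Suc n) b \<circ> q))) =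
        (\<Sum>y\<in>{1..Suc n}. F ((exc_fun q)(y := Suc n)))" .
  qed
  finally show ?thesis .
qed

text \<open>Both sums obey the same recursion. \<open>F\<close> must stay arbitrary, because the
  induction hypothesis is applied to the sum of \<open>F\<close> over all updates with value
  \<open>Suc n\<close>.\<close>

lemma desc_fun_exc_fun_equidistributed:
  fixes F :: "(nat \<Rightarrow> nat) \<Rightarrow> 'a::comm_monoid_add"
  shows "(\<Sum>w | w permutes {1..n}. F (desc_fun w)) = (\<Sum>w | w permutes {1..n}. F (exc_fun w))"
proof (induction n arbitrary: F)
  case 0
  have "desc_fun id = exc_fun id"
    by (auto simp: desc_fun_def exc_fun_def fun_eq_iff)
  then show ?case by (simp add: id_def)
next
  case (Suc n)
  show ?case
    unfolding sum_desc_fun_Suc sum_exc_fun_Suc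
    by (rule Suc.IH[of "\<lambda>e. \<Sum>y\<in>{1..Suc n}. F (e(y := Suc n))"])
qed

section \<open>The four statistics\<close>

lemma exc_eq: "exc n w = card {y \<in> {1..n}. exc_fun w y > y}"
  unfolding exc_def exc_fun_def by (rule arg_cong[of _ _ card]) auto

lemma total_exc_eq: "total_exc n w = (\<Sum>y\<in>{1..n}. exc_fun w y - y)"
  unfolding total_exc_def exc_fun_def by (intro sum.cong) auto

text \<open>A descent is recorded by its lower letter, the one whose left neighbour is
  larger.\<close>

lemma bij_betw_descents:
  assumes w: "w permutes {1..n}"
  shows "bij_betw (\<lambda>i. w (i + 1)) {i \<in> {1..<n}. w i > w (i + 1)}
    {y \<in> {1..n}. desc_fun w y > y}"
proof (rule bij_betw_imageI)
  show "inj_on (\<lambda>i. w (i + 1)) {i \<in> {1..<n}. w i > w (i + 1)}"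
    using permutes_inj[OF w] by (auto intro!: inj_onI dest: injD)
  have w_in: "w i \<in> {1..n} \<longleftrightarrow> i \<in> {1..n}" for i
    using permutes_in_image[OF w] .
  have w0: "w 0 = 0" using w by (simp add: permutes_not_in)
  show "(\<lambda>i. w (i + 1)) ` {i \<in> {1..<n}. w i > w (i + 1)} = {y \<in> {1..n}. desc_fun w y > y}"
  proof (intro equalityI subsetI)
    fix y assume "y \<in> (\<lambda>i. w (i + 1)) ` {i \<in> {1..<n}. w i > w (i + 1)}"
    then obtain i where i: "y = w (i + 1)" "i \<in> {1..<n}" "w i > w (i + 1)" by auto
    then show "y \<in> {y \<in> {1..n}. desc_fun w y > y}"
      using w_in[of "i + 1"] desc_fun_apply[OF w, of "i + 1"] by simp
  next
    fix y assume "y \<in> {y \<in> {1..n}. desc_fun w y > y}"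
    then have y: "y \<in> {1..n}" "desc_fun w y > y" by auto
    obtain j where j: "y = w j" using permutes_surj[OF w] by (metis surjD)
    then have jn: "j \<in> {1..n}" using y w_in by blast
    have less: "w (j - 1) > w j" using y j desc_fun_apply[OF w, of j] by simp
    \<comment> \<open>The first letter is excluded: its left neighbour \<open>w 0 = 0\<close>
      exceeds nothing.\<close>
    then have "j - 1 \<noteq> 0" using w0 by (metis not_less_zero)
    then show "y \<in> (\<lambda>i. w (i + 1)) ` {i \<in> {1..<n}. w i > w (i + 1)}"
      using j jn less by (intro image_eqI[of _ _ "j - 1"]) auto
  qed
qed

lemma des_eq:
  assumes "w permutes {1..n}"
  shows "des n w = card {y \<in> {1..n}. desc_fun w y > y}"
  unfolding des_def by (rule bij_betw_same_card[OF bij_betw_descents[OF assms]])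

lemma drops_eq:
  assumes "w permutes {1..n}"
  shows "drops n w = (\<Sum>y\<in>{1..n}. desc_fun w y - y)"
proof -
  have "drops n w =
      (\<Sum>i\<in>{i \<in> {1..<n}. w i > w (i + 1)}. desc_fun w (w (i + 1)) - w (i + 1))"
    unfolding drops_def by (intro sum.cong refl) (simp add: desc_fun_apply[OF assms])
  also have "\<dots> = (\<Sum>y\<in>{y \<in> {1..n}. desc_fun w y > y}. desc_fun w y - y)"
    by (rule sum.reindex_bij_betw[OF bij_betw_descents[OF assms]])
  \<comment> \<open>Letters that are not the lower end of a descent contribute 0.\<close>
  also have "\<dots> = (\<Sum>y\<in>{1..n}. desc_fun w y - y)"
    by (intro sum.mono_neutral_left) auto
  finally show ?thesis .
qed

text \<open>A general \<open>G\<close> covers both claims: monomials in \<open>q\<close> and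
  \<open>t\<close> give the polynomial identity, an indicator function gives the count.\<close>

lemma drops_des_dp_exc_equidistributed:
  fixes G :: "nat \<Rightarrow> nat \<Rightarrow> 'a::comm_monoid_add"
  shows "(\<Sum>w | w permutes {1..n}. G (drops n w) (des n w)) =
    (\<Sum>w | w permutes {1..n}. G (dp n w) (exc n w))"
proof -
  let ?F = "\<lambda>e. G (\<Sum>y\<in>{1..n}. e y - y) (card {y \<in> {1..n}. e y > y})"
  have "(\<Sum>w | w permutes {1..n}. G (drops n w) (des n w)) =
      (\<Sum>w | w permutes {1..n}. ?F (desc_fun w))"
    by (intro sum.cong refl) (simp only: mem_Collect_eq drops_eq des_eq)
  also have "\<dots> = (\<Sum>w | w permutes {1..n}. ?F (exc_fun w))"
    by (rule desc_fun_exc_fun_equidistributed)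
  also have "\<dots> = (\<Sum>w | w permutes {1..n}. G (dp n w) (exc n w))"
    by (intro sum.cong refl) (simp only: mem_Collect_eq dp_eq_total_exc total_exc_eq exc_eq)
  finally show ?thesis .
qed

theorem theorem1p3:
  fixes n :: nat
  assumes "n \<ge> 1"
  shows "(\<Sum>w | w permutes {1..n}. q_var ^ drops n w * t_var ^ des n w) =
           (\<Sum>w | w permutes {1..n}. q_var ^ dp n w * t_var ^ exc n w)
         \<and> (\<forall>k::nat. card {w. w permutes {1..n} \<and> dp n w = k} =
                     card {w. w permutes {1..n} \<and> drops n w = k})"
proof (intro conjI allI)
  show "(\<Sum>w | w permutes {1..n}. q_var ^ drops n w * t_var ^ des n w) =
      (\<Sum>w | w permutes {1..n}. q_var ^ dp n w * t_var ^ exc n w)"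
    by (rule drops_des_dp_exc_equidistributed)
next
  fix k
  have card_eq: "card {w. w permutes {1..n} \<and> f w = k} =
      (\<Sum>w | w permutes {1..n}. if f w = k then 1 else 0)" for f :: "(nat \<Rightarrow> nat) \<Rightarrow> nat"
    by (simp add: sum.If_cases finite_permutations Collect_conj_eq)
  show "card {w. w permutes {1..n} \<and> dp n w = k} = card {w. w permutes {1..n} \<and> drops n w = k}"
    unfolding card_eq
    by (rule drops_des_dp_exc_equidistributed[of "\<lambda>d _. if d = k then 1 else 0", symmetric])
qed

end
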